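(* Take any function $\mathsf s\colon[0,\infty]\times[0,1]\to[-\infty,\infty]$. Then there exists at most one function $\mathsf r\colon[-\infty,\infty]\times[0,1]\to[-\infty,\infty]$ such that the restriction of $\mathsf r$ to $[0,\infty]\times[0,1]$ equals $\mathsf s$ and $\mathsf r=\mathsf r_\mu$ for some zero-mean probability measure $\mu$ on $\mathcal B(\mathbb R)$ such that $\mu_-$ is non-atomic, where $\mu_-(A):=\mu(A\cap(-\infty,0))$ for $A\in\mathcal B(\mathbb R)$. (The same conclusion holds with "$\mu$ is non-atomic" in place of "$\mu_-$ is non-atomic".)
   Context: $\mathcal B(\mathbb R)$ is the Borel $\sigma$-algebra. A probability measure $\mu$ on $\mathcal B(\mathbb R)$ is zero-mean if $\int|x|\,\mu(dx)<\infty$ and $\int x\,\mu(dx)=0$. Reciprocating function $\mathsf r_\mu$. Extend $\mu$ to $[-\infty,\infty]$ by $\mu(\{\pm\infty\})=0$ and define $G\colon[-\infty,\infty]\to[0,\infty)$ by $G(x)=\int_{(0,x]}z\,\mu(dz)$ for $x\in[0,\infty]$ and $G(x)=\int_{[x,0)}(-z)\,\mu(dz)$ for $x\in[-\infty,0]$. For $h\in[-\infty,\infty]$ let $x_+(h)=\inf\{x\in[0,\infty]\colon G(x)\ge h\}$ and $x_-(h)=\sup\{x\in[-\infty,0]\colon G(x)\ge h\}$ (with $\inf\emptyset=\infty$, $\sup\emptyset=-\infty$). For $u\in[0,1]$ let $\tilde G(x,u)=G(x-)+(G(x)-G(x-))u$ if $x\in[0,\infty]$ and $\tilde G(x,u)=G(x+)+(G(x)-G(x+))u$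 if $x\in[-\infty,0]$ (one-sided limits; $G$ is continuous at $0$). Then $\mathsf r_\mu(x,u)=x_-(\tilde G(x,u))$ if $x\in[0,\infty]$ and $\mathsf r_\mu(x,u)=x_+(\tilde G(x,u))$ if $x\in[-\infty,0]$. *)

theory Defs
  imports "HOL-Probability.Probability"
begin

text \<open>
  Measures on the Borel sets of the reals are of type \<^typ>\<open>real measure\<close>; a probability measure
  on them is a \<^locale>\<open>real_distribution\<close>. The extended line is \<^typ>\<open>ereal\<close>.
\<close>

definition zero_mean_distribution :: "real measure \<Rightarrow> bool" where
  "zero_mean_distribution \<mu> \<longleftrightarrow>
     real_distribution \<mu> \<and> integrable \<mu> (\<lambda>z. z) \<and> (LINT z|\<mu>. z) = 0"

text \<open>
  The extension of \<open>\<mu>\<close> to the extended line has no mass at the two infinite points, so the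
  integrals over \<open>(0,x]\<close> and \<open>[x,0)\<close> are taken over the real points of these intervals.
\<close>

definition G_fun :: "real measure \<Rightarrow> ereal \<Rightarrow> real" where
  "G_fun \<mu> x =
     (if 0 \<le> x then LINT z:{z. 0 < z \<and> ereal z \<le> x}|\<mu>. z
      else LINT z:{z. x \<le> ereal z \<and> z < 0}|\<mu>. - z)"

text \<open>In \<^typ>\<open>ereal\<close> the infimum and supremum of the empty set are \<open>\<infinity>\<close> and \<open>-\<infinity>\<close>.\<close>

definition x_plus :: "real measure \<Rightarrow> ereal \<Rightarrow> ereal" where
  "x_plus \<mu> h = Inf {x \<in> {0..}. h \<le> ereal (G_fun \<mu> x)}"

definition x_minus :: "real measure \<Rightarrow> ereal \<Rightarrow> ereal" where
  "x_minus \<mu> h = Sup {x \<in> {..0}. h \<le> ereal (G_fun \<mu> x)}"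

text \<open>
  At \<open>x = 0\<close> the two clauses of the definitions below agree, since \<^const>\<open>G_fun\<close> vanishes and
  is continuous there.
\<close>

definition G_tilde :: "real measure \<Rightarrow> ereal \<Rightarrow> real \<Rightarrow> real" where
  "G_tilde \<mu> x u =
     (let l = Lim (if 0 \<le> x then at_left x else at_right x) (G_fun \<mu>)
      in l + (G_fun \<mu> x - l) * u)"

text \<open>
  The value at pairs outside \<open>[-\<infinity>,\<infinity>] \<times> [0,1]\<close> is \<^const>\<open>undefined\<close>, so that equality in HOL is
  equality of functions on this domain.
\<close>

definition reciprocating :: "real measure \<Rightarrow> ereal \<times> real \<Rightarrow> ereal" where
  "reciprocating \<mu> = (\<lambda>(x, u) \<in> UNIV \<times> {0..1}.
     if 0 \<le> x then x_minus \<mu> (ereal (G_tilde \<mu> x u))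
     else x_plus \<mu> (ereal (G_tilde \<mu> x u)))"

definition is_atom :: "'a measure \<Rightarrow> 'a set \<Rightarrow> bool" where
  "is_atom M A \<longleftrightarrow> A \<in> sets M \<and> 0 < emeasure M A \<and>
     (\<forall>B \<in> sets M. B \<subseteq> A \<longrightarrow> emeasure M B = 0 \<or> emeasure M (A - B) = 0)"

definition nonatomic :: "'a measure \<Rightarrow> bool" where
  "nonatomic M \<longleftrightarrow> (\<nexists>A. is_atom M A)"

definition neg_part :: "real measure \<Rightarrow> real measure" where
  "neg_part \<mu> = density \<mu> (indicator {..<0})"

lemma sets_neg_part [simp]: "sets (neg_part \<mu>) = sets \<mu>"
  by (simp add: neg_part_def)

lemma emeasure_neg_part:
  assumes "sets \<mu> = sets borel" "A \<in> sets borel"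
  shows "emeasure (neg_part \<mu>) A = emeasure \<mu> (A \<inter> {..<0})"
proof -
  have A: "A \<in> sets \<mu>" and N: "{..<0} \<in> sets \<mu>"
    using assms by auto
  have "emeasure (neg_part \<mu>) A = (\<integral>\<^sup>+ z. indicator {..<0} z * indicator A z \<partial>\<mu>)"
    unfolding neg_part_def using A N by (intro emeasure_density borel_measurable_indicator)
  also have "\<dots> = (\<integral>\<^sup>+ z. indicator (A \<inter> {..<0}) z \<partial>\<mu>)"
    by (intro nn_integral_cong) (simp split: split_indicator)
  also have "\<dots> = emeasure \<mu> (A \<inter> {..<0})"
    using A N by (intro nn_integral_indicator) auto
  finally show ?thesis .
qed

end

theory Submission
  imports Defs
begin

text \<open>
  If \<open>\<mu>\<close> has no atoms on the negative half-line, then \<open>G\<close> is continuous there, so \<open>G (x\<^sub>- h) = h\<close> for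
  every level \<open>0 \<le> h \<le> G \<infinity>\<close> and \<open>r\<^sub>\<mu> (x, u) = x\<^sub>+ (G x)\<close> for \<open>x < 0\<close>. The values of \<open>r\<^sub>\<mu>\<close> on the
  nonnegative half-line are exactly the points \<open>x\<^sub>- h\<close>, since the jumps of \<open>G\<close> there are filled in by
  \<open>u\<close>. Hence, for \<open>y \<ge> 0 > x\<close>, the condition \<open>G x \<le> G y\<close> says that \<open>r\<^sub>\<mu> (y, 1)\<close> lies below every value
  \<open>w \<ge> x\<close> of \<open>r\<^sub>\<mu>\<close> on the nonnegative half-line; the least such \<open>w\<close> is \<open>x\<^sub>- (G x)\<close>. So \<open>x\<^sub>+ (G x)\<close> can be
  read off from the restriction of \<open>r\<^sub>\<mu>\<close>.
\<close>

section \<open>The integrand of \<open>G\<close> near a given endpoint\<close>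

definition G_integrand :: "ereal \<Rightarrow> real \<Rightarrow> real" where
  "G_integrand x z =
     (if 0 \<le> x then if 0 < z \<and> ereal z \<le> x then z else 0
      else if x \<le> ereal z \<and> z < 0 then - z else 0)"

lemma G_fun_eq_integral: "G_fun \<mu> x = (LINT z|\<mu>. G_integrand x z)"
  unfolding G_fun_def G_integrand_def set_lebesgue_integral_def
  by (cases "0 \<le> x"; simp only: if_True if_False; intro Bochner_Integration.integral_cong refl)
    (simp_all add: indicator_def)

lemma measurable_G_integrand [measurable]: "G_integrand x \<in> borel_measurable borel"
  unfolding G_integrand_def by measurable

lemma G_integrand_nonneg: "0 \<le> G_integrand x z"
  by (auto simp: G_integrand_def)

lemma abs_G_integrand_le: "\<bar>G_integrand x z\<bar> \<le> \<bar>z\<bar>"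
  by (auto simp: G_integrand_def)

text \<open>For fixed \<open>z\<close> the integrand is piecewise constant as a function of the
  endpoint while that endpoint stays on one side of \<open>0\<close>, and for \<open>z < 0\<close>
  it changes only when the endpoint crosses \<open>z\<close>. Near \<open>a = 0\<close> no
  \<open>z\<close> is exceptional.\<close>

lemma eventually_G_integrand_at_nonpos:
  assumes "a \<le> 0" "ereal z \<noteq> a \<or> 0 \<le> z"
  shows "\<forall>\<^sub>F x in at a. G_integrand x z = G_integrand a z"
proof -
  consider "z > 0" | "z = 0" | "z < 0" "ereal z < a" | "z < 0" "a < ereal z"
    using assms by (cases "ereal z" a rule: linorder_cases) force+
  then show ?thesis
  proof cases
    case 1
    then have "\<forall>\<^sub>F x in at a. x < ereal z"
      using assms by (intro order_tendstoD[OF tendsto_ident_at]) (auto intro: le_less_trans)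
    then show ?thesis
      by eventually_elim (use 1 assms in \<open>auto simp: G_integrand_def\<close>)
  next
    case 2
    then show ?thesis by (simp add: G_integrand_def)
  next
    case 3
    then have "\<forall>\<^sub>F x in at a. ereal z < x"
      by (intro order_tendstoD[OF tendsto_ident_at])
    then show ?thesis
      by eventually_elim (use 3 in \<open>auto simp: G_integrand_def\<close>)
  next
    case 4
    then have "\<forall>\<^sub>F x in at a. x < ereal z"
      by (intro order_tendstoD[OF tendsto_ident_at])
    then show ?thesis
    proof eventually_elim
      case (elim x)
      have "ereal z < 0" using 4 by simp
      then have "x < 0" "a < 0" using elim 4 by (meson less_trans)+
      then show ?case using elim 4 by (auto simp: G_integrand_def)
    qed
  qed
qed

text \<open>The interval (0,x] is closed at \<open>x\<close>, so moving the endpoint to the right of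
  \<open>a\<close> keeps a point at \<open>a\<close> itself; hence there is no exceptional
  \<open>z\<close> here.\<close>

lemma eventually_G_integrand_at_right:
  assumes "0 \<le> a"
  shows "\<forall>\<^sub>F x in at_right a. G_integrand x z = G_integrand a z"
proof (cases "ereal z \<le> a")
  case True
  have "\<forall>\<^sub>F x in at_right a. a < x"
    by (simp add: eventually_at_filter)
  then show ?thesis
    by eventually_elim (use True assms in \<open>auto simp: G_integrand_def\<close>)
next
  case False
  then have "\<forall>\<^sub>F x in at_right a. x < ereal z"
    by (intro order_tendstoD[OF tendsto_ident_at]) auto
  moreover have "\<forall>\<^sub>F x in at_right a. a < x"
    by (simp add: eventually_at_filter)
  ultimately show ?thesis
    by eventually_elim (use False assms in \<open>auto simp: G_integrand_def\<close>)
qed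

text \<open>Uniqueness of limits needs a nontrivial filter, and in \<open>ereal\<close> the left
  filter is trivial at the least point; the witness \<open>y\<close> excludes that point.\<close>

lemma at_left_neq_bot:
  fixes x y :: "'a :: {linorder_topology, dense_order}"
  assumes "y < x"
  shows "at_left x \<noteq> bot"
proof
  assume "at_left x = bot"
  then have "\<forall>\<^sub>F z in at_left x. False" by simp
  then show False
    unfolding eventually_at_left[OF assms] using dense by blast
qed

lemma at_right_neq_bot:
  fixes x y :: "'a :: {linorder_topology, dense_order}"
  assumes "x < y"
  shows "at_right x \<noteq> bot"
proof
  assume "at_right x = bot"
  then have "\<forall>\<^sub>F z in at_right x. False" by simp
  then show False
    unfolding eventually_at_right[OF assms] using dense by blast
qed

section \<open>\<open>G\<close> for an arbitrary zero-mean measure\<close>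

locale zero_mean =
  fixes \<mu> :: "real measure"
  assumes zero_mean: "zero_mean_distribution \<mu>"
begin

sublocale real_distribution \<mu>
  using zero_mean by (simp add: zero_mean_distribution_def)

lemma integrable_id: "integrable \<mu> (\<lambda>z. z)"
  using zero_mean by (simp add: zero_mean_distribution_def)

lemma integrable_G_integrand: "integrable \<mu> (G_integrand x)"
  by (rule Bochner_Integration.integrable_bound[OF integrable_id])
     (auto simp: abs_G_integrand_le)

lemma G_fun_nonneg: "0 \<le> G_fun \<mu> x"
  by (simp add: G_fun_eq_integral G_integrand_nonneg)

lemma G_fun_0 [simp]: "G_fun \<mu> 0 = 0"
proof -
  have "G_integrand 0 = (\<lambda>z. 0)" by (auto simp: G_integrand_def fun_eq_iff)
  then show ?thesis by (simp add: G_fun_eq_integral)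
qed

lemma G_fun_mono: "0 \<le> x \<Longrightarrow> x \<le> y \<Longrightarrow> G_fun \<mu> x \<le> G_fun \<mu> y"
  unfolding G_fun_eq_integral
  by (intro integral_mono integrable_G_integrand) (auto simp: G_integrand_def)

lemma G_fun_antimono: "x \<le> y \<Longrightarrow> y \<le> 0 \<Longrightarrow> G_fun \<mu> y \<le> G_fun \<mu> x"
  unfolding G_fun_eq_integral
  by (intro integral_mono integrable_G_integrand) (auto simp: G_integrand_def)

text \<open>The two integrands are the positive and the negative part of \<open>z\<close>, so their
  difference integrates to the mean.\<close>

lemma G_fun_minus_infinity: "G_fun \<mu> (-\<infinity>) = G_fun \<mu> \<infinity>"
proof -
  have "G_fun \<mu> \<infinity> - G_fun \<mu> (-\<infinity>) = (LINT z|\<mu>. G_integrand \<infinity> z - G_integrand (-\<infinity>) z)"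
    unfolding G_fun_eq_integral
    by (intro Bochner_Integration.integral_diff[symmetric] integrable_G_integrand)
  also have "\<dots> = (LINT z|\<mu>. z)"
    by (intro Bochner_Integration.integral_cong) (auto simp: G_integrand_def)
  also have "\<dots> = 0"
    using zero_mean by (simp add: zero_mean_distribution_def)
  finally show ?thesis by simp
qed

text \<open>Dominated convergence along sequences, with the integrable majorant
  \<open>\<bar>z\<bar>\<close> for every endpoint.\<close>

lemma G_fun_tendsto:
  assumes "AE z in \<mu>. \<forall>\<^sub>F x in at a within S. G_integrand x z = G_integrand a z"
  shows "(G_fun \<mu> \<longlongrightarrow> G_fun \<mu> a) (at a within S)"
  unfolding tendsto_at_iff_sequentially
proof (intro allI impI)
  fix X assume X: "\<forall>i. X i \<in> S - {a}" "X \<longlonglongrightarrow> a"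
  then have lim: "filterlim X (at a within S) sequentially"
    by (simp add: filterlim_at)
  have "(\<lambda>i. LINT z|\<mu>. G_integrand (X i) z) \<longlonglongrightarrow> (LINT z|\<mu>. G_integrand a z)"
  proof (rule integral_dominated_convergence[where w = "\<lambda>z. \<bar>z\<bar>"])
    show "AE z in \<mu>. (\<lambda>i. G_integrand (X i) z) \<longlonglongrightarrow> G_integrand a z"
      using assms
    proof eventually_elim
      case (elim z)
      then have "((\<lambda>x. G_integrand x z) \<longlongrightarrow> G_integrand a z) (at a within S)"
        by (rule tendsto_eventually)
      from filterlim_compose[OF this lim] show ?case .
    qed
    show "integrable \<mu> (\<lambda>z. \<bar>z\<bar>)"
      using integrable_id by (rule integrable_abs)
    show "AE z in \<mu>. norm (G_integrand (X i) z) \<le> \<bar>z\<bar>" for i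
      by (rule AE_I2) (simp add: abs_G_integrand_le)
  qed measurable
  then show "(G_fun \<mu> \<circ> X) \<longlonglongrightarrow> G_fun \<mu> a"
    unfolding comp_def G_fun_eq_integral .
qed

lemma G_fun_right_continuous: "0 \<le> a \<Longrightarrow> (G_fun \<mu> \<longlongrightarrow> G_fun \<mu> a) (at_right a)"
  by (rule G_fun_tendsto, rule AE_I2, rule eventually_G_integrand_at_right)

text \<open>Monotonicity alone gives the left limit, so atoms of \<open>\<mu>\<close> on the
  positive half-line do no harm.\<close>

lemma G_fun_left_limit:
  assumes "0 < y"
  shows "(G_fun \<mu> \<longlongrightarrow> Sup (G_fun \<mu> ` {0..<y})) (at_left y)"
proof (rule increasing_tendsto)
  have bdd: "bdd_above (G_fun \<mu> ` {0..<y})"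
    by (rule bdd_aboveI2[where M = "G_fun \<mu> y"]) (auto intro: G_fun_mono)
  have ev: "\<forall>\<^sub>F x in at_left y. c < x \<and> x < y" if "c < y" for c
    using that by (auto simp: eventually_at_left[OF that])
  show "\<forall>\<^sub>F x in at_left y. G_fun \<mu> x \<le> Sup (G_fun \<mu> ` {0..<y})"
    using ev[OF assms] by eventually_elim (rule cSUP_upper[OF _ bdd], auto)
  fix c assume "c < Sup (G_fun \<mu> ` {0..<y})"
  then obtain w where w: "0 \<le> w" "w < y" "c < G_fun \<mu> w"
    using bdd assms by (subst (asm) less_cSUP_iff) auto
  show "\<forall>\<^sub>F x in at_left y. c < G_fun \<mu> x"
    using ev[OF w(2)] by eventually_elim (rule less_le_trans[OF w(3) G_fun_mono[OF w(1)]], auto)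
qed

lemma Lim_left_G_fun: "0 < y \<Longrightarrow> Lim (at_left y) (G_fun \<mu>) = Sup (G_fun \<mu> ` {0..<y})"
  by (rule tendsto_Lim[OF at_left_neq_bot G_fun_left_limit])

lemma G_tilde_1 [simp]: "G_tilde \<mu> x 1 = G_fun \<mu> x"
  by (simp add: G_tilde_def Let_def)

text \<open>Take for \<open>y\<close> the first point where \<open>G\<close> reaches
  \<open>h\<close>. Right continuity gives \<open>h \<le> G y\<close>, while the left limit at
  \<open>y > 0\<close> is at most \<open>h\<close>; if \<open>G\<close> jumps over \<open>h\<close>,
  then \<open>u\<close> interpolates.\<close>

lemma exists_G_tilde:
  assumes h: "0 \<le> h" "h \<le> G_fun \<mu> \<infinity>"
  shows "\<exists>y\<in>{0..}. \<exists>u\<in>{0..1}. G_tilde \<mu> y u = h"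
proof -
  define S where "S = {x \<in> {0..}. h \<le> G_fun \<mu> x}"
  define y where "y = Inf S"
  have y0: "0 \<le> y"
    unfolding y_def S_def by (auto intro: Inf_greatest)
  \<comment> \<open>The point \<infinity> cannot be approached from the right; there the claim is
    the assumed bound on \<open>h\<close>.\<close>
  have hy: "h \<le> G_fun \<mu> y"
  proof (cases "y = \<infinity>")
    case False
    then have "y < \<infinity>" by simp
    have "\<forall>\<^sub>F x in at_right y. y < x" by (simp add: eventually_at_filter)
    then have "\<forall>\<^sub>F x in at_right y. h \<le> G_fun \<mu> x"
    proof eventually_elim
      case (elim x)
      then obtain w where "w \<in> S" "w < x" unfolding y_def Inf_less_iff by blast
      then have "0 \<le> w" "h \<le> G_fun \<mu> w" "w \<le> x" by (auto simp: S_def)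
      then show ?case using G_fun_mono[of w x] by linarith
    qed
    moreover have "at_right y \<noteq> bot"
      using \<open>y < \<infinity>\<close> by (rule at_right_neq_bot)
    ultimately show ?thesis
      by (rule tendsto_lowerbound[OF G_fun_right_continuous[OF y0]])
  qed (use h in simp)
  show ?thesis
  proof (cases "h = G_fun \<mu> y")
    case True
    then show ?thesis using y0 by (intro bexI[of _ y] bexI[of _ 1]) auto
  next
    case False
    with hy have lt: "h < G_fun \<mu> y" by simp
    with h have "y \<noteq> 0" by auto
    with y0 have y: "0 < y" by simp
    define l where "l = Sup (G_fun \<mu> ` {0..<y})"
    have "l \<le> h"
      unfolding l_def
    proof (rule cSUP_least)
      fix x assume x: "x \<in> {0..<y}"
      show "G_fun \<mu> x \<le> h"
      proof (rule ccontr)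
        assume "\<not> G_fun \<mu> x \<le> h"
        with x have "x \<in> S" by (auto simp: S_def)
        then have "y \<le> x" unfolding y_def by (rule Inf_lower)
        with x show False by auto
      qed
    qed (use y in auto)
    \<comment> \<open>The solution of \<open>l + (G y - l) * u = h\<close>; since
      \<open>l \<le> h < G y\<close>, it lies in the unit interval.\<close>
    define u where "u = (h - l) / (G_fun \<mu> y - l)"
    have "u \<in> {0..1}" "G_tilde \<mu> y u = h"
      using \<open>l \<le> h\<close> lt y0 by (auto simp: u_def G_tilde_def Lim_left_G_fun[OF y] l_def[symmetric])
    then show ?thesis using y0 by blast
  qed
qed

end

section \<open>Measures without point masses on the negative half-line\<close>

locale zero_mean_diffuse_left = zero_mean +
  assumes emeasure_singleton: "z < 0 \<Longrightarrow> emeasure \<mu> {z} = 0"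
begin

text \<open>The integrand can fail to be locally constant only at \<open>z = a < 0\<close>, a null
  set by assumption. At \<open>0\<close> and at \<open>-\<infinity>\<close> there is no such
  \<open>z\<close>.\<close>

lemma G_fun_continuous:
  assumes "a \<le> 0"
  shows "isCont (G_fun \<mu>) a"
  unfolding isCont_def
proof (rule G_fun_tendsto)
  have "AE z in \<mu>. ereal z \<noteq> a \<or> 0 \<le> z"
  proof (cases "\<exists>b<0. a = ereal b")
    case True
    then obtain b where b: "b < 0" "a = ereal b" by blast
    then have "AE z in \<mu>. z \<noteq> b"
      using emeasure_singleton by (intro AE_I[of _ _ "{b}"]) auto
    then show ?thesis by eventually_elim (use b in auto)
  next
    case False
    then show ?thesis by (intro AE_I2) (auto simp: not_less)
  qed
  then show "AE z in \<mu>. \<forall>\<^sub>F x in at a. G_integrand x z = G_integrand a z"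
    by eventually_elim (use assms eventually_G_integrand_at_nonpos in blast)
qed

text \<open>By continuity the superlevel set is closed, so it contains its supremum. That supremum
  lies to the right of a point of level exactly \<open>h\<close>, so by antitonicity its level is at
  most \<open>h\<close>.\<close>

lemma G_fun_x_minus:
  assumes h: "0 \<le> h" "h \<le> G_fun \<mu> \<infinity>"
  shows "x_minus \<mu> (ereal h) \<le> 0" "G_fun \<mu> (x_minus \<mu> (ereal h)) = h"
proof -
  define S where "S = {x \<in> {..0}. h \<le> G_fun \<mu> x}"
  have eq: "x_minus \<mu> (ereal h) = Sup S"
    by (simp add: x_minus_def S_def)
  have cont: "continuous_on {..0} (G_fun \<mu>)"
    using G_fun_continuous by (auto intro: continuous_at_imp_continuous_on)
  \<comment> \<open>Mean zero makes the value at \<open>-\<infinity>\<close> equal to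
    \<open>G \<infinity>\<close>, so every admissible \<open>h\<close> lies between the values at
    the two ends.\<close>
  obtain a where a: "a \<le> 0" "G_fun \<mu> a = h"
    using IVT2'[of "G_fun \<mu>" 0 h "-\<infinity>"] h continuous_on_subset[OF cont]
    by (auto simp: G_fun_minus_infinity)
  then have aS: "a \<in> S" by (simp add: S_def)
  have "closed S"
  proof -
    have "closed {x \<in> {..0}. G_fun \<mu> x \<in> {h..}}"
      using continuous_closed_preimage[OF cont, of "{h..}"] by (simp add: vimage_def Int_def)
    then show ?thesis by (simp add: S_def)
  qed
  then have "Sup S \<in> S"
    using aS by (intro closed_contains_Sup_cl) auto
  then show "x_minus \<mu> (ereal h) \<le> 0"
    by (simp add: eq S_def)
  have "G_fun \<mu> (Sup S) \<le> h"
    using G_fun_antimono[of a "Sup S"] aS \<open>Sup S \<in> S\<close> a by (auto simp: S_def intro: Sup_upper)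
  then show "G_fun \<mu> (x_minus \<mu> (ereal h)) = h"
    using \<open>Sup S \<in> S\<close> by (auto simp: eq S_def)
qed

lemma Lim_left_G_fun_0: "Lim (at_left 0) (G_fun \<mu>) = 0"
proof (rule tendsto_Lim)
  show "(G_fun \<mu> \<longlongrightarrow> 0) (at_left 0)"
    using G_fun_continuous[of 0] unfolding isCont_def by (auto intro: tendsto_within_subset)
qed (rule at_left_neq_bot[of "-\<infinity>"], simp)

text \<open>A convex combination of the left limit and the value of \<open>G\<close>; the bounds
  make every level coming from the nonnegative half-line admissible for
  \<open>G_fun_x_minus\<close>.\<close>

lemma G_tilde_bounds:
  assumes "0 \<le> y" "u \<in> {0..1}"
  shows "0 \<le> G_tilde \<mu> y u" "G_tilde \<mu> y u \<le> G_fun \<mu> \<infinity>"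
proof -
  define l where "l = Lim (at_left y) (G_fun \<mu>)"
  have l: "0 \<le> l \<and> l \<le> G_fun \<mu> y"
  proof (cases "y = 0")
    case False
    with assms have y: "0 < y" by simp
    have "bdd_above (G_fun \<mu> ` {0..<y})"
      by (rule bdd_aboveI2[where M = "G_fun \<mu> y"]) (auto intro: G_fun_mono)
    then have "G_fun \<mu> 0 \<le> Sup (G_fun \<mu> ` {0..<y})"
      using y by (intro cSUP_upper) auto
    then have "0 \<le> l"
      by (simp add: l_def Lim_left_G_fun[OF y])
    moreover have "l \<le> G_fun \<mu> y"
      unfolding l_def Lim_left_G_fun[OF y] using y by (intro cSUP_least) (auto intro: G_fun_mono)
    ultimately show ?thesis ..
  qed (auto simp: l_def Lim_left_G_fun_0)
  have eq: "G_tilde \<mu> y u = l + (G_fun \<mu> y - l) * u"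
    using assms by (simp add: G_tilde_def l_def Let_def)
  show "0 \<le> G_tilde \<mu> y u"
    unfolding eq using l assms(2) by (intro add_nonneg_nonneg mult_nonneg_nonneg) auto
  have "(G_fun \<mu> y - l) * u \<le> G_fun \<mu> y - l"
    using l assms(2) by (intro mult_left_le) auto
  moreover have "G_fun \<mu> y \<le> G_fun \<mu> \<infinity>"
    using assms(1) by (intro G_fun_mono) auto
  ultimately show "G_tilde \<mu> y u \<le> G_fun \<mu> \<infinity>"
    unfolding eq by linarith
qed

lemma G_tilde_neg:
  assumes "x < 0"
  shows "G_tilde \<mu> x u = G_fun \<mu> x"
proof -
  have "Lim (at_right x) (G_fun \<mu>) = G_fun \<mu> x"
  proof (rule tendsto_Lim)
    show "(G_fun \<mu> \<longlongrightarrow> G_fun \<mu> x) (at_right x)"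
      using G_fun_continuous[of x] assms unfolding isCont_def
      by (metis less_imp_le subset_UNIV tendsto_within_subset)
  qed (use assms in \<open>rule at_right_neq_bot\<close>)
  then show ?thesis using assms by (auto simp: G_tilde_def Let_def)
qed

text \<open>The right-hand side sees \<open>\<mu>\<close> only through \<open>r\<close> on the
  nonnegative half-line; \<open>u = 1\<close> selects the level \<open>G y\<close> itself. Forwards,
  \<open>x \<le> x_minus h\<close> forces \<open>h \<le> G x \<le> G y\<close>, and
  \<open>x_minus\<close> is antitone in the level.\<close>

lemma G_fun_le_iff:
  assumes x: "x < 0" and y: "0 \<le> y"
  shows "G_fun \<mu> x \<le> G_fun \<mu> y \<longleftrightarrow>
    (\<forall>p \<in> {0..} \<times> {0..1}. x \<le> reciprocating \<mu> p \<longrightarrow> reciprocating \<mu> (y, 1) \<le> reciprocating \<mu> p)"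
  (is "_ \<longleftrightarrow> ?R")
proof
  have top: "G_fun \<mu> y \<le> G_fun \<mu> \<infinity>" using y by (intro G_fun_mono) auto
  have ry: "reciprocating \<mu> (y, 1) = x_minus \<mu> (ereal (G_fun \<mu> y))"
    using y by (simp add: reciprocating_def)
  {
    assume le: "G_fun \<mu> x \<le> G_fun \<mu> y"
    show ?R
    proof (intro ballI impI)
      fix p assume p: "p \<in> {0..} \<times> {0..1::real}" "x \<le> reciprocating \<mu> p"
      obtain y' u where p_eq: "p = (y', u)" by force
      define h where "h = G_tilde \<mu> y' u"
      have h: "0 \<le> h" "h \<le> G_fun \<mu> \<infinity>"
        using p by (auto simp: h_def p_eq intro!: G_tilde_bounds)
      have rp: "reciprocating \<mu> p = x_minus \<mu> (ereal h)"
        using p by (auto simp: reciprocating_def h_def p_eq)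
      have "h \<le> G_fun \<mu> x"
        using G_fun_antimono[of x "x_minus \<mu> (ereal h)"] G_fun_x_minus[OF h] p(2)[unfolded rp]
        by simp
      with le have "h \<le> G_fun \<mu> y" by simp
      then show "reciprocating \<mu> (y, 1) \<le> reciprocating \<mu> p"
        unfolding rp ry x_minus_def by (intro Sup_subset_mono) auto
    qed
  next
    assume R: ?R
    have "G_fun \<mu> x \<le> G_fun \<mu> \<infinity>"
      using G_fun_antimono[of "-\<infinity>" x] x by (simp add: G_fun_minus_infinity)
    note Gx = G_fun_nonneg[of x] this
    \<comment> \<open>Backwards, the test pair is one of level \<open>G x\<close>; it qualifies
      because \<open>x\<close> belongs to the set whose supremum is
      \<open>x_minus (G x)\<close>.\<close>
    obtain y' u where p: "0 \<le> y'" "u \<in> {0..1}" "G_tilde \<mu> y' u = G_fun \<mu> x"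
      using exists_G_tilde[OF Gx] by auto
    then have rp: "reciprocating \<mu> (y', u) = x_minus \<mu> (ereal (G_fun \<mu> x))"
      by (simp add: reciprocating_def)
    have "x \<le> x_minus \<mu> (ereal (G_fun \<mu> x))"
      unfolding x_minus_def using x by (intro Sup_upper) auto
    with R p rp have "reciprocating \<mu> (y, 1) \<le> x_minus \<mu> (ereal (G_fun \<mu> x))"
      by (metis SigmaI atLeast_iff)
    \<comment> \<open>Applying the antitone \<open>G\<close> recovers the levels, since
      \<open>G (x_minus h) = h\<close>.\<close>
    then have "G_fun \<mu> (x_minus \<mu> (ereal (G_fun \<mu> x))) \<le> G_fun \<mu> (x_minus \<mu> (ereal (G_fun \<mu> y)))"
      unfolding ry using G_fun_x_minus(1)[OF Gx] by (rule G_fun_antimono)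
    then show "G_fun \<mu> x \<le> G_fun \<mu> y"
      by (simp add: G_fun_x_minus Gx G_fun_nonneg top)
  }
qed

text \<open>Without jumps on the left \<open>u\<close> has no effect, so the value is
  \<open>x_plus (G x)\<close>, whose defining set is rewritten in terms of \<open>r\<close> on the
  nonnegative half-line.\<close>

lemma reciprocating_neg:
  assumes "x < 0" "u \<in> {0..1}"
  shows "reciprocating \<mu> (x, u) =
    Inf {y \<in> {0..}. \<forall>p \<in> {0..} \<times> {0..1}.
      x \<le> reciprocating \<mu> p \<longrightarrow> reciprocating \<mu> (y, 1) \<le> reciprocating \<mu> p}"
proof -
  have "reciprocating \<mu> (x, u) = x_plus \<mu> (ereal (G_fun \<mu> x))"
    using assms by (auto simp: reciprocating_def G_tilde_neg)
  also have "\<dots> = Inf {y \<in> {0..}. G_fun \<mu> x \<le> G_fun \<mu> y}"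
    by (simp add: x_plus_def)
  also have "\<dots> = Inf {y \<in> {0..}. \<forall>p \<in> {0..} \<times> {0..1}.
      x \<le> reciprocating \<mu> p \<longrightarrow> reciprocating \<mu> (y, 1) \<le> reciprocating \<mu> p}"
    using G_fun_le_iff[OF assms(1)] by (intro arg_cong[where f = Inf] Collect_cong) auto
  finally show ?thesis .
qed

end

section \<open>From non-atomicity to uniqueness\<close>

lemma is_atom_singleton:
  assumes "{z} \<in> sets M" "emeasure M {z} \<noteq> 0"
  shows "is_atom M {z}"
  unfolding is_atom_def
  using assms by (auto simp: zero_less_iff_neq_zero subset_singleton_iff)

text \<open>A negative point of positive mass would be an atom of
  \<open>neg_part \<mu>\<close>.\<close>

lemma zero_mean_diffuse_left_neg_part:
  assumes "zero_mean_distribution \<mu>" "nonatomic (neg_part \<mu>)"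
  shows "zero_mean_diffuse_left \<mu>"
proof
  have sets: "sets \<mu> = sets borel"
    using assms(1) by (simp add: zero_mean_distribution_def real_distribution_def
        real_distribution_axioms_def)
  fix z :: real assume z: "z < 0"
  then have "{z} \<inter> {..<0} = {z}" by auto
  then have "emeasure \<mu> {z} = emeasure (neg_part \<mu>) {z}"
    by (simp add: emeasure_neg_part sets)
  also have "\<dots> = 0"
    using assms(2) is_atom_singleton[of z "neg_part \<mu>"] by (auto simp: nonatomic_def sets)
  finally show "emeasure \<mu> {z} = 0" .
qed (rule assms(1))

lemma zero_mean_diffuse_left_nonatomic:
  assumes "zero_mean_distribution \<mu>" "nonatomic \<mu>"
  shows "zero_mean_diffuse_left \<mu>"
proof
  have "sets \<mu> = sets borel"
    using assms(1) by (simp add: zero_mean_distribution_def real_distribution_def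
        real_distribution_axioms_def)
  then show "emeasure \<mu> {z} = 0" for z
    using assms(2) is_atom_singleton[of z \<mu>] by (auto simp: nonatomic_def)
qed (rule assms(1))

lemma reciprocating_unique:
  assumes "zero_mean_diffuse_left \<mu>" "zero_mean_diffuse_left \<nu>"
    and eq: "restrict (reciprocating \<mu>) ({0..} \<times> {0..1}) = restrict (reciprocating \<nu>) ({0..} \<times> {0..1})"
  shows "reciprocating \<mu> = reciprocating \<nu>"
proof (rule ext, clarify)
  fix x :: ereal and u :: real
  have pos: "reciprocating \<mu> p = reciprocating \<nu> p" if "p \<in> {0..} \<times> {0..1}" for p
    using fun_cong[OF eq, of p] that by (simp only: restrict_apply if_True)
  consider "u \<notin> {0..1}" | "u \<in> {0..1}" "0 \<le> x" | "u \<in> {0..1}" "x < 0" by force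
  then show "reciprocating \<mu> (x, u) = reciprocating \<nu> (x, u)"
  proof cases
    \<comment> \<open>Outside the domain both functions take the default value
      \<open>undefined\<close>.\<close>
    case 1
    then show ?thesis by (auto simp: reciprocating_def)
  next
    case 2
    then show ?thesis by (intro pos) auto
  next
    case 3
    show ?thesis
      unfolding zero_mean_diffuse_left.reciprocating_neg[OF assms(1) 3(2,1)]
        zero_mean_diffuse_left.reciprocating_neg[OF assms(2) 3(2,1)]
      by (intro arg_cong[where f = Inf] Collect_cong conj_cong refl ball_cong) (simp add: pos)
  qed
qed

theorem proposition3p30:
  fixes s :: "ereal \<times> real \<Rightarrow> ereal"
  assumes "s \<in> ({0..} \<times> {0..1}) \<rightarrow>\<^sub>E UNIV"
  shows "(\<exists>\<^sub>\<le>\<^sub>1 r. r \<in> (UNIV \<times> {0..1}) \<rightarrow>\<^sub>E UNIV \<and> restrict r ({0..} \<times> {0..1}) = s \<and>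
            (\<exists>\<mu>. zero_mean_distribution \<mu> \<and> nonatomic (neg_part \<mu>) \<and> r = reciprocating \<mu>)) \<and>
         (\<exists>\<^sub>\<le>\<^sub>1 r. r \<in> (UNIV \<times> {0..1}) \<rightarrow>\<^sub>E UNIV \<and> restrict r ({0..} \<times> {0..1}) = s \<and>
            (\<exists>\<mu>. zero_mean_distribution \<mu> \<and> nonatomic \<mu> \<and> r = reciprocating \<mu>))"
proof (intro conjI Uniq_I; elim conjE exE)
  fix q r \<mu> \<nu>
  assume "zero_mean_distribution \<mu>" "nonatomic (neg_part \<mu>)" "q = reciprocating \<mu>"
    "zero_mean_distribution \<nu>" "nonatomic (neg_part \<nu>)" "r = reciprocating \<nu>"
    "restrict q ({0..} \<times> {0..1}) = s" "restrict r ({0..} \<times> {0..1}) = s"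
  then show "q = r"
    using reciprocating_unique zero_mean_diffuse_left_neg_part by metis
next
  fix q r \<mu> \<nu>
  assume "zero_mean_distribution \<mu>" "nonatomic \<mu>" "q = reciprocating \<mu>"
    "zero_mean_distribution \<nu>" "nonatomic \<nu>" "r = reciprocating \<nu>"
    "restrict q ({0..} \<times> {0..1}) = s" "restrict r ({0..} \<times> {0..1}) = s"
  then show "q = r"
    using reciprocating_unique zero_mean_diffuse_left_nonatomic by metis
qed

end
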